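(* Let $B>3$ be an odd integer, and let $c_{\max}(B)$ be the largest length of a terminal cycle of the four-digit Kaprekar map in base $B$. If $c_{\max}(B)=\frac{B-1}{2}$ (so that $B$ is prime), then the number of terminal cycles of length $c_{\max}(B)$ is $$\left\lfloor\frac{c_{\max}(B)-1}{2}\right\rfloor.$$
   Context: A four-digit string in base $B$ is a sequence of four digits in $\{0,\dots,B-1\}$ (leading zeros allowed). The four-digit Kaprekar map in base $B$ sends a string whose digits sorted in non-increasing order are $a_1\ge a_2\ge a_3\ge a_4$ to the four-digit base-$B$ string (with leading zeros if needed) of the number $$(a_1B^3+a_2B^2+a_3B+a_4)-(a_4B^3+a_3B^2+a_2B+a_1).$$ Constant strings (all four digits equal) are excluded throughout. A terminal cycle is a periodic orbit of this map consisting of nonconstant strings, and its length is the number of distinct strings in it (the minimal period). *)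

theory Defs
  imports
    Complex_Main
    "HOL-Computational_Algebra.Primes"
    "HOL-Combinatorics.Orbits"
begin

text \<open>Strings are lists of digits, most significant digit first.\<close>

definition four_digit_strings :: "nat \<Rightarrow> nat list set" where
  "four_digit_strings B = {s. length s = 4 \<and> set s \<subseteq> {..<B}}"

definition nonconstant_strings :: "nat \<Rightarrow> nat list set" where
  "nonconstant_strings B = {s \<in> four_digit_strings B. \<nexists>c. s = replicate 4 c}"

definition string_value :: "nat \<Rightarrow> nat list \<Rightarrow> nat" where
  "string_value B s = s ! 0 * B ^ 3 + s ! 1 * B ^ 2 + s ! 2 * B + s ! 3"

definition string_of_number :: "nat \<Rightarrow> nat \<Rightarrow> nat list" where
  "string_of_number B n =
     [n div B ^ 3 mod B, n div B ^ 2 mod B, n div B mod B, n mod B]"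

text \<open>The list \<open>a\<close> is \<open>s\<close> in non-increasing order, so the value of \<open>a\<close> is at least
  that of \<open>rev a\<close> and the subtraction on \<^typ>\<open>nat\<close> does not truncate.\<close>

definition kaprekar :: "nat \<Rightarrow> nat list \<Rightarrow> nat list" where
  "kaprekar B s =
     (let a = rev (sort s)
      in string_of_number B (string_value B a - string_value B (rev a)))"

text \<open>Since \<open>orbit f s\<close> consists of the iterates \<open>(f ^^ n) s\<close> with \<open>n \<ge> 1\<close>, the
  condition \<open>s \<in> orbit f s\<close> says that \<open>s\<close> is a periodic point of \<open>f\<close>.  A cycle is
  its set of strings, so that its length is its cardinality.\<close>

definition terminal_cycles :: "nat \<Rightarrow> nat list set set" where
  "terminal_cycles B =
     {C. C \<subseteq> nonconstant_strings B \<and>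
         (\<exists>s. s \<in> orbit (kaprekar B) s \<and> C = orbit (kaprekar B) s)}"

definition c_max :: "nat \<Rightarrow> nat" where
  "c_max B = Max (card ` terminal_cycles B)"

end

theory Submission
  imports Defs
begin

text \<open>
  The image of a string depends only on \<open>x = a\<^sub>1 - a\<^sub>4\<close> and \<open>y = a\<^sub>2 - a\<^sub>3\<close>, and after a few
  steps \<open>x\<close> and \<open>y\<close> are distinct odd numbers below \<open>B\<close>. On such pairs the map
  acts by \<open>x \<mapsto> \<bar>B - 2 x\<bar>\<close> in each coordinate, followed by sorting. Since every nonzero
  class of \<open>\<int>/B\<close> modulo sign has exactly one odd representative below \<open>B\<close>, this is doubling
  on \<open>(\<int>/B)/\<plusminus>1\<close>. The period \<open>n\<close> of \<open>1\<close> bounds all cycle lengths, and \<open>n \<le> (B - 1)/2\<close>, the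
  number of odd representatives. In case of equality all of them are \<open>\<plusminus>2\<^sup>k\<close> modulo \<open>B\<close>, so \<open>B\<close>
  has no proper divisor, and the cycles are the orbits of a rotation by one on the
  two-element subsets of \<open>\<int>/m\<close>, \<open>m = (B - 1)/2\<close>: one for each distance \<open>d \<le> m/2\<close>, of length
  \<open>m\<close> unless \<open>d = m/2\<close>.
\<close>

section \<open>Orbits of injective self-maps of finite sets\<close>

lemma funpow_in:
  assumes "f ` A \<subseteq> A" "x \<in> A"
  shows "(f ^^ k) x \<in> A"
  using assms by (induction k) auto

lemma funpow_cancel_on:
  assumes "f ` A \<subseteq> A" "inj_on f A" "x \<in> A" "(f ^^ (i + k)) x = (f ^^ i) x"
  shows "(f ^^ k) x = x"
  using assms(4)
proof (induction i)
  case (Suc i)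
  have "f ((f ^^ (i + k)) x) = f ((f ^^ i) x)"
    using Suc.prems by simp
  then have "(f ^^ (i + k)) x = (f ^^ i) x"
    using assms(2) funpow_in[OF assms(1,3)] by (meson inj_onD)
  then show ?case by (rule Suc.IH)
qed simp

text \<open>Pigeonhole on the first \<open>card A + 1\<close> iterates gives a collision,
  injectivity turns it into a return to \<open>x\<close>, and before the least return time all
  iterates differ.\<close>

lemma finite_inj_on_period:
  assumes "finite A" "f ` A \<subseteq> A" "inj_on f A" "x \<in> A"
  obtains n where "0 < n" "n \<le> card A" "(f ^^ n) x = x" "inj_on (\<lambda>i. (f ^^ i) x) {..<n}"
proof -
  define P where "P k \<longleftrightarrow> 0 < k \<and> (f ^^ k) x = x" for k
  have collision: "P (j - i)" if "i < j" "(f ^^ i) x = (f ^^ j) x" for i j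
    using funpow_cancel_on[OF assms(2-4), of i "j - i"] that by (simp add: P_def)
  have "\<not> inj_on (\<lambda>i. (f ^^ i) x) {..card A}"
  proof
    assume "inj_on (\<lambda>i. (f ^^ i) x) {..card A}"
    then have "card {..card A} \<le> card A"
      by (rule card_inj_on_le) (use funpow_in[OF assms(2,4)] assms(1) in auto)
    then show False by simp
  qed
  then obtain i j where "i < j" "j \<le> card A" "(f ^^ i) x = (f ^^ j) x"
    unfolding inj_on_def by (metis atMost_iff linorder_neq_iff)
  then have ex: "P (j - i)" "j - i \<le> card A"
    using collision by auto
  define n where "n = (LEAST k. P k)"
  have "P n" "n \<le> j - i"
    unfolding n_def using ex(1) by (auto intro: LeastI Least_le)
  moreover have "inj_on (\<lambda>i. (f ^^ i) x) {..<n}"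
  proof (rule linorder_inj_onI')
    fix i j assume "i \<in> {..<n}" "j \<in> {..<n}" "i < j"
    then have "\<not> P (j - i)"
      unfolding n_def by (intro not_less_Least) auto
    then show "(f ^^ i) x \<noteq> (f ^^ j) x"
      using collision \<open>i < j\<close> by blast
  qed
  ultimately show thesis
    using that ex(2) by (auto simp: P_def)
qed

lemma card_orbit_le:
  assumes "0 < n" "(f ^^ n) x = x"
  shows "card (orbit f x) \<le> n"
proof -
  have "orbit f x = (\<lambda>i. (f ^^ i) x) ` {..<n}"
    using orbit_altdef_bounded[OF assms(2,1)] by auto
  then show ?thesis
    using card_image_le[of "{..<n}" "\<lambda>i. (f ^^ i) x"] by simp
qed

lemma orbit_eq_orbit:
  assumes "x \<in> orbit f x" "y \<in> orbit f x"
  shows "orbit f y = orbit f x"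
  using assms by (meson orbit_cyclic_eq3 cyclic_on_def)

section \<open>The map on digit differences\<close>

lemma string_of_number_digits:
  assumes "a < B" "b < B" "c < B" "d < B"
  shows "string_of_number B (a * B ^ 3 + b * B ^ 2 + c * B + d) = [a, b, c, d]"
proof -
  \<comment> \<open>Horner form: each division by \<open>B\<close> strips the last digit.\<close>
  have eq: "a * B ^ 3 + b * B ^ 2 + c * B + d = ((a * B + b) * B + c) * B + d"
    by (simp add: algebra_simps power2_eq_square power3_eq_cube)
  have 1: "(((a * B + b) * B + c) * B + d) div B = (a * B + b) * B + c"
    and 2: "((a * B + b) * B + c) div B = a * B + b"
    and 3: "(a * B + b) div B = a"
    using assms by auto
  have "n div B ^ 2 = n div B div B" "n div B ^ 3 = n div B div B div B" for n
    by (simp_all add: power2_eq_square power3_eq_cube div_mult2_eq)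
  then show ?thesis
    unfolding string_of_number_def eq using assms by (simp only: 1 2 3) simp
qed

text \<open>For \<open>0 < x < B\<close> and \<open>y \<le> x\<close>, these are the
  base-\<open>B\<close> digits of \<open>x * (B ^ 3 - 1) + y * (B ^ 2 - B)\<close> after borrowing.
  If \<open>y = 0\<close>, the second digit \<open>y - 1\<close> would be negative, so the borrow
  reaches the leading digit.\<close>

definition diff_string :: "nat \<Rightarrow> nat \<Rightarrow> nat \<Rightarrow> nat list" where
  "diff_string B x y =
     (if y = 0 then [x - 1, B - 1, B - 1, B - x] else [x, y - 1, B - 1 - y, B - x])"

lemma string_of_number_diff:
  assumes "0 < x" "x < B" "y \<le> x"
  shows "string_of_number B (x * (B ^ 3 - 1) + y * (B ^ 2 - B)) = diff_string B x y"
proof (cases "y = 0")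
  case True
  have "int (x * (B ^ 3 - 1)) = int x * (int B ^ 3 - 1)"
    using assms by (simp add: of_nat_diff)
  also have "\<dots> = int ((x - 1) * B ^ 3 + (B - 1) * B ^ 2 + (B - 1) * B + (B - x))"
    using assms by (simp add: of_nat_diff power2_eq_square power3_eq_cube algebra_simps)
  finally have "x * (B ^ 3 - 1) = (x - 1) * B ^ 3 + (B - 1) * B ^ 2 + (B - 1) * B + (B - x)"
    by (simp only: of_nat_eq_iff)
  then show ?thesis
    using True assms string_of_number_digits[of "x - 1" B "B - 1" "B - 1" "B - x"]
    by (simp add: diff_string_def)
next
  case False
  have "int (x * (B ^ 3 - 1) + y * (B ^ 2 - B))
      = int x * (int B ^ 3 - 1) + int y * (int B ^ 2 - int B)"
    using assms by (simp add: of_nat_diff power2_eq_square)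
  also have "\<dots> = int x * int B ^ 3 + int (y - 1) * int B ^ 2 + int (B - 1 - y) * int B + int (B - x)"
    using assms False by (simp add: of_nat_diff power2_eq_square power3_eq_cube algebra_simps)
  also have "\<dots> = int (x * B ^ 3 + (y - 1) * B ^ 2 + (B - 1 - y) * B + (B - x))"
    by simp
  finally have "x * (B ^ 3 - 1) + y * (B ^ 2 - B)
      = x * B ^ 3 + (y - 1) * B ^ 2 + (B - 1 - y) * B + (B - x)"
    by (simp only: of_nat_eq_iff)
  then show ?thesis
    using False assms string_of_number_digits[of x B "y - 1" "B - 1 - y" "B - x"]
    by (simp add: diff_string_def)
qed

lemma kaprekar_eq_diff_string:
  assumes "mset s = {#a, b, c, d#}" "d \<le> c" "c \<le> b" "b \<le> a" "d < a" "a < B"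
  shows "kaprekar B s = diff_string B (a - d) (b - c)"
proof -
  have "sort s = [d, c, b, a]"
    by (rule properties_for_sort) (use assms in \<open>auto simp: add_mset_commute\<close>)
  then have "kaprekar B s = string_of_number B
      (a * B ^ 3 + b * B ^ 2 + c * B + d - (d * B ^ 3 + c * B ^ 2 + b * B + a))"
    by (simp add: kaprekar_def string_value_def)
  also have "a * B ^ 3 + b * B ^ 2 + c * B + d - (d * B ^ 3 + c * B ^ 2 + b * B + a)
      = (a - d) * (B ^ 3 - 1) + (b - c) * (B ^ 2 - B)"
  proof -
    \<comment> \<open>Additive witnesses replace the truncated subtractions, leaving a polynomial
      identity.\<close>
    obtain r t where "a = d + r" "b = c + t"
      using assms(3,4,2) by (metis le_add_diff_inverse le_trans)
    moreover obtain p where "B ^ 3 = Suc p"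
      using assms(6) by (metis gr0_implies_Suc zero_less_power not_less_zero neq0_conv)
    moreover obtain q where "B ^ 2 = B + q"
      by (metis le_add_diff_inverse le_square power2_eq_square)
    ultimately show ?thesis by (simp add: algebra_simps)
  qed
  finally show ?thesis
    using assms string_of_number_diff[of "a - d" B "b - c"] by auto
qed

section \<open>Digit differences in an odd base\<close>

locale odd_base =
  fixes B :: nat
  assumes B_gt: "B > 3" and odd_B: "odd B"
begin

text \<open>This is the absolute value of \<open>B - 2 * x\<close>. It is the distance between the
  digits \<open>x\<close> and \<open>B - x\<close>, and also between \<open>x - 1\<close> and
  \<open>B - 1 - x\<close>.\<close>

definition f :: "nat \<Rightarrow> nat" where
  "f x = (if 2 * x < B then B - 2 * x else 2 * x - B)"

definition odds :: "nat set" where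
  "odds = {x. odd x \<and> x < B}"

text \<open>Sorting the arguments makes this a function of the unordered pair, so \<open>f\<close>
  can act on each entry without tracking which is larger.\<close>

definition T :: "nat \<Rightarrow> nat \<Rightarrow> nat list" where
  "T x y = diff_string B (max x y) (min x y)"

text \<open>This set turns out to be the union of all terminal cycles.\<close>

definition recurrent :: "nat list set" where
  "recurrent = {T x y | x y. x \<in> odds \<and> y \<in> odds \<and> x \<noteq> y}"

lemma T_commute: "T x y = T y x"
  by (simp add: T_def max.commute min.commute)

lemma odds_pos: "x \<in> odds \<Longrightarrow> 0 < x"
  by (auto simp: odds_def intro: Nat.gr0I)

lemma finite_odds: "finite odds"
  by (simp add: odds_def)

lemma card_odds: "card odds = (B - 1) div 2"
proof -
  have "odds = (\<lambda>i. 2 * i + 1) ` {..<(B - 1) div 2}"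
    using odd_B by (auto simp: odds_def image_iff elim!: oddE)
  moreover have "inj_on (\<lambda>i::nat. 2 * i + 1) {..<(B - 1) div 2}"
    by (auto simp: inj_on_def)
  ultimately show ?thesis
    by (simp add: card_image)
qed

lemma f_in_odds: "0 < x \<Longrightarrow> x < B \<Longrightarrow> f x \<in> odds"
  using odd_B by (auto simp: f_def odds_def)

lemma f_odds: "f ` odds \<subseteq> odds"
  using f_in_odds odds_pos by (auto simp: odds_def)

lemma f_eq_iff: "f x = f y \<longleftrightarrow> x = y \<or> x + y = B"
  using odd_B by (auto simp: f_def elim!: oddE)

text \<open>Two odd numbers cannot add up to the odd number \<open>B\<close>.\<close>

lemma inj_on_f: "inj_on f odds"
  using odd_B by (auto simp: inj_on_def f_eq_iff odds_def)

text \<open>The digits split into a pair with sum \<open>B\<close> and distance \<open>f x\<close>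
  and a pair with sum \<open>B - 2\<close> and distance \<open>f y\<close>. If the distances differ,
  one pair encloses the other and the new differences are \<open>f x\<close> and \<open>f y\<close>;
  if they agree, the pairs interlace with offset 1.\<close>

lemma kaprekar_diff_string:
  assumes "0 < y" "y \<le> x" "x < B"
  shows "kaprekar B (diff_string B x y)
    = (if f x = f y then diff_string B (f x + 1) (f x - 1) else T (f x) (f y))"
proof -
  let ?a = "max x (B - x)" and ?b = "min x (B - x)"
  let ?c = "max (y - 1) (B - 1 - y)" and ?d = "min (y - 1) (B - 1 - y)"
  have ms: "mset (diff_string B x y) = {#?a, ?b, ?c, ?d#}"
    using assms by (auto simp: diff_string_def max_def min_def add_mset_commute)
  have sum: "?a + ?b = B" "?c + ?d = B - 2"
    using assms by auto
  have fx: "?a = ?b + f x"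
    using assms by (auto simp: f_def max_def min_def)
  have fy: "?c = ?d + f y"
    using assms by (auto simp: f_def max_def min_def)
  have odd: "odd (f x)" "odd (f y)"
    using f_in_odds assms by (auto simp: odds_def)
  have bnd: "?a < B" "?c < B" "f x > 0" "f y > 0"
    using assms odd by (auto intro: Nat.gr0I)
  define a b c d u v where "a = ?a" and "b = ?b" and "c = ?c" and "d = ?d"
    and "u = f x" and "v = f y"
  note defs = this
  note ms = ms[folded defs] and lin = sum[folded defs] fx[folded defs] fy[folded defs]
    bnd[folded defs] B_gt
  \<comment> \<open>Both distances are odd, so they cannot differ by exactly 1.\<close>
  consider "u = v" | "u \<ge> v + 2" | "v \<ge> u + 2"
    using odd[folded defs] by (cases u v rule: linorder_cases) (auto elim!: oddE)
  then show ?thesis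
    unfolding T_def defs(5,6)[symmetric]
  proof cases
    case 1
    have "kaprekar B (diff_string B x y) = diff_string B (a - d) (c - b)"
    proof (rule kaprekar_eq_diff_string)
      show "mset (diff_string B x y) = {#a, c, b, d#}"
        using ms by (simp add: add_mset_commute)
    qed (use 1 lin in linarith)+
    moreover have "a - d = u + 1" "c - b = u - 1"
      using 1 lin by linarith+
    ultimately show "kaprekar B (diff_string B x y) = (if u = v
      then diff_string B (u + 1) (u - 1) else diff_string B (max u v) (min u v))"
      using 1 by simp
  next
    case 2
    have "kaprekar B (diff_string B x y) = diff_string B (a - b) (c - d)"
    proof (rule kaprekar_eq_diff_string)
      show "mset (diff_string B x y) = {#a, c, d, b#}"
        using ms by (simp add: add_mset_commute)
    qed (use 2 lin in linarith)+
    moreover have "a - b = u" "c - d = v"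
      using 2 lin by linarith+
    ultimately show "kaprekar B (diff_string B x y) = (if u = v
      then diff_string B (u + 1) (u - 1) else diff_string B (max u v) (min u v))"
      using 2 by simp
  next
    case 3
    have "kaprekar B (diff_string B x y) = diff_string B (c - d) (a - b)"
    proof (rule kaprekar_eq_diff_string)
      show "mset (diff_string B x y) = {#c, a, b, d#}"
        using ms by (simp add: add_mset_commute)
    qed (use 3 lin in linarith)+
    moreover have "a - b = u" "c - d = v"
      using 3 lin by linarith+
    ultimately show "kaprekar B (diff_string B x y) = (if u = v
      then diff_string B (u + 1) (u - 1) else diff_string B (max u v) (min u v))"
      using 3 by simp
  qed
qed

text \<open>The digits are \<open>x - 1\<close>, \<open>B - x\<close> and twice
  \<open>B - 1\<close>, and the two copies of \<open>B - 1\<close> come first after sorting.\<close>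

lemma kaprekar_diff_string_0:
  assumes "0 < x" "x < B"
  shows "kaprekar B (diff_string B x 0)
    = diff_string B (B - 1 - min (x - 1) (B - x)) (B - 1 - max (x - 1) (B - x))"
proof (rule kaprekar_eq_diff_string)
  show "mset (diff_string B x 0) = {#B - 1, B - 1, max (x - 1) (B - x), min (x - 1) (B - x)#}"
    by (auto simp: diff_string_def max_def min_def add_mset_commute)
qed (use assms B_gt in auto)

lemma kaprekar_T:
  assumes "x \<in> odds" "y \<in> odds" "x \<noteq> y"
  shows "kaprekar B (T x y) = T (f x) (f y)"
proof -
  have "f x \<noteq> f y"
    using assms inj_on_f by (meson inj_onD)
  then show ?thesis
    using assms kaprekar_diff_string[of "min x y" "max x y"] odds_pos
    by (auto simp: T_def max_def min_def odds_def)
qed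

text \<open>The first two digits are the maximum and the minimum less 1; since the entries are
  positive, both can be recovered.\<close>

lemma T_eq_T_iff:
  assumes "x \<in> odds" "y \<in> odds" "x' \<in> odds" "y' \<in> odds"
  shows "T x y = T x' y' \<longleftrightarrow> x = x' \<and> y = y' \<or> x = y' \<and> y = x'"
proof
  have pos: "0 < x" "0 < y" "0 < x'" "0 < y'"
    using assms odds_pos by auto
  assume "T x y = T x' y'"
  then have "max x y = max x' y'" "min x y - 1 = min x' y' - 1"
    using pos by (simp_all add: T_def diff_string_def split: if_splits)
  then show "x = x' \<and> y = y' \<or> x = y' \<and> y = x'"
    using pos by (auto simp: max_def min_def split: if_splits)
qed (auto simp: T_commute)

section \<open>The map permutes the recurrent strings\<close>

lemma finite_recurrent: "finite recurrent"
proof -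
  have "recurrent \<subseteq> (\<lambda>(x, y). T x y) ` (odds \<times> odds)"
    by (auto simp: recurrent_def)
  then show ?thesis
    using finite_odds by (meson finite_SigmaI finite_imageI finite_subset)
qed

lemma kaprekar_recurrent: "kaprekar B ` recurrent \<subseteq> recurrent"
proof
  fix s assume "s \<in> kaprekar B ` recurrent"
  then obtain x y where xy: "x \<in> odds" "y \<in> odds" "x \<noteq> y" "s = kaprekar B (T x y)"
    by (auto simp: recurrent_def)
  moreover have "f x \<in> odds" "f y \<in> odds" "f x \<noteq> f y"
    using xy f_odds inj_on_f by (auto dest: inj_onD)
  ultimately show "s \<in> recurrent"
    by (auto simp: recurrent_def kaprekar_T)
qed

lemma inj_on_kaprekar: "inj_on (kaprekar B) recurrent"
proof (rule inj_onI)
  fix s t assume st: "s \<in> recurrent" "t \<in> recurrent" "kaprekar B s = kaprekar B t"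
  obtain x y where xy: "x \<in> odds" "y \<in> odds" "x \<noteq> y" "s = T x y"
    using st(1) by (auto simp: recurrent_def)
  obtain x' y' where xy': "x' \<in> odds" "y' \<in> odds" "x' \<noteq> y'" "t = T x' y'"
    using st(2) by (auto simp: recurrent_def)
  have "T (f x) (f y) = T (f x') (f y')"
    using st(3) xy xy' by (simp add: kaprekar_T)
  moreover have "f x \<in> odds" "f y \<in> odds" "f x' \<in> odds" "f y' \<in> odds"
    using xy xy' f_odds by auto
  ultimately have "f x = f x' \<and> f y = f y' \<or> f x = f y' \<and> f y = f x'"
    by (simp add: T_eq_T_iff)
  then have "x = x' \<and> y = y' \<or> x = y' \<and> y = x'"
    using xy xy' inj_on_f by (meson inj_onD)
  then show "s = t"
    using xy xy' by (auto simp: T_commute)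
qed

lemma kaprekar_funpow_T:
  assumes "x \<in> odds" "y \<in> odds" "x \<noteq> y"
  shows "(kaprekar B ^^ k) (T x y) = T ((f ^^ k) x) ((f ^^ k) y)"
proof (induction k)
  case (Suc k)
  have "(f ^^ k) x \<noteq> (f ^^ k) y"
  proof -
    have "inj_on (f ^^ k) odds"
    proof (induction k)
      case (Suc k)
      then show ?case
        using inj_on_f funpow_in[OF f_odds] by (auto simp: inj_on_def)
    qed simp
    then show ?thesis
      using assms by (meson inj_onD)
  qed
  then show ?case
    using Suc assms funpow_in[OF f_odds] by (simp add: kaprekar_T)
qed simp

section \<open>Terminal cycles\<close>

text \<open>An injective self-map of a finite set is a permutation, so every point is
  periodic.\<close>

lemma recurrent_in_orbit: "s \<in> recurrent \<Longrightarrow> s \<in> orbit (kaprekar B) s"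
  by (rule finite_inj_on_period[OF finite_recurrent kaprekar_recurrent inj_on_kaprekar])
    (auto simp: orbit_altdef intro: sym)

lemma recurrent_nonconstant: "recurrent \<subseteq> nonconstant_strings B"
proof
  fix s assume "s \<in> recurrent"
  then obtain x y where xy: "x \<in> odds" "y \<in> odds" "x \<noteq> y" "s = T x y"
    by (auto simp: recurrent_def)
  define a b where "a = max x y" and "b = min x y"
  have "odd a" "a < B" "odd b" "b < a" "0 < b"
    using xy odds_pos by (auto simp: a_def b_def max_def min_def odds_def)
  moreover from this have "s = [a, b - 1, B - 1 - b, B - a]"
    using xy by (simp add: T_def a_def b_def diff_string_def)
  \<comment> \<open>The first digit \<open>a\<close> exceeds the second digit
    \<open>b - 1\<close>.\<close>
  ultimately show "s \<in> nonconstant_strings B"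
    by (auto simp: nonconstant_strings_def four_digit_strings_def numeral_eq_Suc)
qed

text \<open>One step leads to some \<open>diff_string B x y\<close>. If \<open>0 < y\<close> and
  \<open>f x \<noteq> f y\<close>, the next step is recurrent. The remaining cases,
  \<open>f x = f y\<close> or \<open>y = 0\<close>, are led to this one in a few more steps.\<close>

lemma eventually_recurrent:
  assumes "s \<in> nonconstant_strings B"
  shows "\<exists>k. (kaprekar B ^^ k) s \<in> recurrent"
proof -
  define reaches where "reaches s \<longleftrightarrow> (\<exists>k. (kaprekar B ^^ k) s \<in> recurrent)" for s
  have base: "reaches s" if "s \<in> recurrent" for s
    using that unfolding reaches_def by (metis funpow_0)
  have step: "reaches s" if "reaches (kaprekar B s)" for s
    using that unfolding reaches_def by (metis comp_apply funpow_Suc_right)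
  have good: "reaches (diff_string B x y)" if "0 < y" "y \<le> x" "x < B" "f x \<noteq> f y" for x y
  proof -
    have "f x \<in> odds" "f y \<in> odds"
      using that f_in_odds by auto
    then show ?thesis
      using that kaprekar_diff_string[of y x]
      by (intro step[OF base]) (auto simp: recurrent_def)
  qed
  \<comment> \<open>The exceptional pairs (1, 0), (B - 1, 0) and (2, 0) all run into (B - 2, 1),
    which is good because its entries differ and do not sum to \<open>B\<close>.\<close>
  have r1: "reaches (diff_string B (B - 2) 1)"
    using B_gt odd_B by (intro good) (auto simp: f_eq_iff)
  have r2: "reaches (diff_string B 2 0)"
  proof (rule step)
    have "B - 1 - min (2 - 1) (B - 2) = B - 2" "B - 1 - max (2 - 1) (B - 2) = 1"
      using B_gt by auto
    then show "reaches (kaprekar B (diff_string B 2 0))"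
      using kaprekar_diff_string_0[of 2] B_gt r1 by simp
  qed
  have r3: "reaches (diff_string B (B - 1) 0)"
  proof (rule step)
    have "B - 1 - min (B - 1 - 1) (B - (B - 1)) = B - 2" "B - 1 - max (B - 1 - 1) (B - (B - 1)) = 1"
      using B_gt by auto
    then show "reaches (kaprekar B (diff_string B (B - 1) 0))"
      using kaprekar_diff_string_0[of "B - 1"] B_gt r1 by simp
  qed
  have r4: "reaches (diff_string B 1 0)"
    using kaprekar_diff_string_0[of 1] B_gt r3 by - (rule step, simp)
  have pos: "reaches (diff_string B x y)" if "0 < y" "y \<le> x" "x < B" for x y
  proof (cases "f x = f y")
    case True
    have f: "odd (f x)" "f x < B"
      using f_in_odds[of x] that by (auto simp: odds_def)
    have "reaches (diff_string B (f x + 1) (f x - 1))"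
    proof (cases "f x = 1")
      case True
      then show ?thesis using r2 by (simp add: numeral_2_eq_2)
    next
      case False
      \<comment> \<open>The entries \<open>u + 1\<close> and \<open>u - 1\<close> are distinct with
        even sum \<open>2 * u\<close>, which is not \<open>B\<close>, so their images under
        \<open>f\<close> differ.\<close>
      define u where "u = f x"
      have "odd u" "u \<noteq> 1" "u < B"
        using f False by (simp_all add: u_def)
      then have "0 < u - 1" "u - 1 \<le> u + 1" "u + 1 < B" "u + 1 + (u - 1) \<noteq> B"
        using odd_B by presburger+
      then show ?thesis
        unfolding u_def[symmetric] by (intro good) (auto simp: f_eq_iff)
    qed
    then show ?thesis
      using kaprekar_diff_string[of y x] that True by - (rule step, simp)
  qed (use that good in blast)
  have all: "reaches (diff_string B x y)" if "0 < x" "y \<le> x" "x < B" for x y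
  proof (cases "y = 0 \<and> x \<noteq> 1")
    case True
    \<comment> \<open>For \<open>x \<noteq> 1\<close> both \<open>x - 1\<close> and
      \<open>B - x\<close> are below \<open>B - 1\<close>, so the new second difference is
      positive.\<close>
    have "reaches (kaprekar B (diff_string B x 0))"
      unfolding kaprekar_diff_string_0[OF that(1,3)]
      using True that by (intro pos) auto
    then show ?thesis
      using step True by blast
  next
    case False
    then show ?thesis
      using that pos r4 by (cases "y = 0") auto
  qed
  have s: "length s = 4" "set s \<subseteq> {..<B}"
    using assms by (auto simp: nonconstant_strings_def four_digit_strings_def)
  obtain a b c d where abcd: "sort s = [d, c, b, a]"
  proof -
    have "length (sort s) = Suc (Suc (Suc (Suc 0)))"
      using s(1) by simp
    then show thesis
      using that by (auto simp only: length_Suc_conv length_0_conv)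
  qed
  have ord: "d \<le> c" "c \<le> b" "b \<le> a"
    using sorted_sort[of s] by (simp_all add: abcd)
  have ms: "mset s = {#a, b, c, d#}"
    using arg_cong[OF abcd, of mset] by (simp add: add_mset_commute)
  have set_s: "set s = {a, b, c, d}"
    using ms by (metis set_mset_mset set_mset_add_mset_insert set_mset_empty)
  have "a \<noteq> d"
  proof
    assume "a = d"
    then have "set s = {a}"
      using ord set_s by auto
    then have "s = replicate 4 a"
      using s(1) by (metis replicate_eqI singletonD)
    then show False
      using assms by (auto simp: nonconstant_strings_def)
  qed
  then have "kaprekar B s = diff_string B (a - d) (b - c)"
    using s set_s ord ms by (intro kaprekar_eq_diff_string) auto
  moreover have "reaches (diff_string B (a - d) (b - c))"
    using \<open>a \<noteq> d\<close> ord s set_s by (intro all) auto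
  ultimately have "reaches s"
    by - (rule step, simp)
  then show ?thesis
    by (simp add: reaches_def)
qed

text \<open>A periodic string reaches a recurrent one, which lies on the same cycle and hence
  generates it. Conversely, orbits of recurrent strings are cycles of nonconstant strings.\<close>

lemma terminal_cycles_eq: "terminal_cycles B = orbit (kaprekar B) ` recurrent"
proof (intro equalityI subsetI)
  fix C assume "C \<in> terminal_cycles B"
  then obtain s where s: "C \<subseteq> nonconstant_strings B" "s \<in> orbit (kaprekar B) s"
      "C = orbit (kaprekar B) s"
    by (auto simp: terminal_cycles_def)
  then obtain k where k: "(kaprekar B ^^ k) s \<in> recurrent"
    using eventually_recurrent by blast
  have "(kaprekar B ^^ k) s \<in> orbit (kaprekar B) s"
    using s(2) by (rule funpow_in_orbit)
  then have "C = orbit (kaprekar B) ((kaprekar B ^^ k) s)"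
    using s orbit_eq_orbit by metis
  then show "C \<in> orbit (kaprekar B) ` recurrent"
    using k by blast
next
  fix C assume "C \<in> orbit (kaprekar B) ` recurrent"
  then obtain s where s: "s \<in> recurrent" "C = orbit (kaprekar B) s"
    by blast
  moreover have "orbit (kaprekar B) s \<subseteq> nonconstant_strings B"
    using funpow_in[OF kaprekar_recurrent s(1)] recurrent_nonconstant
    by (auto simp: orbit_altdef)
  ultimately show "C \<in> terminal_cycles B"
    using recurrent_in_orbit by (auto simp: terminal_cycles_def)
qed

section \<open>Doubling modulo sign\<close>

lemma f_cong: "int B dvd int (f x) - 2 * int x \<or> int B dvd int (f x) + 2 * int x"
  by (auto simp: f_def of_nat_diff)

lemma funpow_f_cong:
  "int B dvd int ((f ^^ k) x) - 2 ^ k * int x \<or> int B dvd int ((f ^^ k) x) + 2 ^ k * int x"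
proof (induction k)
  case (Suc k)
  define z w where "z = int ((f ^^ k) x)" and "w = 2 ^ k * int x"
  define u where "u = int (f ((f ^^ k) x))"
  have "int B dvd u - 2 * z \<or> int B dvd u + 2 * z"
    using f_cong by (auto simp: u_def z_def)
  moreover have "int B dvd 2 * (z - w) \<or> int B dvd 2 * (z + w)"
    using Suc unfolding z_def w_def by (metis dvd_mult)
  \<comment> \<open>One identity for each combination of the two signs.\<close>
  moreover have "u - 2 * w = (u - 2 * z) + 2 * (z - w)" "u + 2 * w = (u - 2 * z) + 2 * (z + w)"
    "u + 2 * w = (u + 2 * z) - 2 * (z - w)" "u - 2 * w = (u + 2 * z) - 2 * (z + w)"
    by algebra+
  ultimately have "int B dvd u - 2 * w \<or> int B dvd u + 2 * w"
    by (metis dvd_add dvd_diff)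
  then show ?case
    by (simp add: u_def w_def mult.assoc)
qed simp

text \<open>Odd representatives modulo sign are unique: a difference divisible by \<open>B\<close>
  vanishes, while a sum divisible by \<open>B\<close> lies strictly between 0 and
  \<open>2 * B\<close>, hence is the odd number \<open>B\<close>, yet it is even.\<close>

lemma odds_eqI:
  assumes "x \<in> odds" "y \<in> odds" "int B dvd int x - int y \<or> int B dvd int x + int y"
  shows "x = y"
  using assms(3)
proof
  assume "int B dvd int x - int y"
  then have "int x mod int B = int y mod int B"
    by (simp add: mod_eq_dvd_iff)
  then show ?thesis
    using assms by (simp add: odds_def)
next
  assume "int B dvd int x + int y"
  then have "B dvd x + y"
    by (metis int_dvd_int_iff of_nat_add)
  then obtain k where k: "x + y = B * k" ..
  have "0 < x + y" "x + y < B * 2" "even (x + y)"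
    using assms(1,2) odds_pos by (auto simp: odds_def)
  then have "0 < k" "k < 2"
    unfolding k by auto
  then have "x + y = B"
    using k by (cases k) auto
  then show ?thesis
    using \<open>even (x + y)\<close> odd_B by simp
qed

lemma one_odds: "1 \<in> odds"
  using B_gt by (simp add: odds_def)

text \<open>A return of 1 after \<open>n\<close> steps means that \<open>2 ^ n\<close> is 1 or -1
  modulo \<open>B\<close>, so multiplying by it fixes every class modulo sign.\<close>

lemma funpow_f_eq_self:
  assumes "(f ^^ n) 1 = 1" "x \<in> odds"
  shows "(f ^^ n) x = x"
proof -
  define z where "z = int ((f ^^ n) x)"
  define w :: int where "w = 2 ^ n"
  have "int B dvd (1 - w) * int x \<or> int B dvd (1 + w) * int x"
    using funpow_f_cong[of n 1] assms(1) by (auto simp: w_def)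
  moreover have "int B dvd z - w * int x \<or> int B dvd z + w * int x"
    unfolding z_def w_def by (rule funpow_f_cong)
  moreover have "z - int x = (z - w * int x) - (1 - w) * int x"
    "z + int x = (z - w * int x) + (1 + w) * int x"
    "z + int x = (z + w * int x) + (1 - w) * int x"
    "z - int x = (z + w * int x) - (1 + w) * int x"
    by algebra+
  ultimately have "int B dvd z - int x \<or> int B dvd z + int x"
    by (metis dvd_add dvd_diff)
  then show ?thesis
    unfolding z_def using assms(2) funpow_in[OF f_odds] by (intro odds_eqI) auto
qed

text \<open>The period \<open>n\<close> of 1 returns both entries of every pair, so no cycle is
  longer than \<open>n\<close>, and \<open>n\<close> is at most \<open>card odds\<close>. The
  hypothesis makes both bounds sharp.\<close>

lemma funpow_f_one_if_c_max:
  assumes "c_max B = (B - 1) div 2"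
  shows "(f ^^ c_max B) 1 = 1" "inj_on (\<lambda>i. (f ^^ i) 1) {..<c_max B}"
proof -
  obtain n where n: "0 < n" "n \<le> card odds" "(f ^^ n) 1 = 1" "inj_on (\<lambda>i. (f ^^ i) 1) {..<n}"
    using finite_inj_on_period[OF finite_odds f_odds inj_on_f one_odds] .
  \<comment> \<open>This makes the set of cycle lengths nonempty, so its maximum is
    attained.\<close>
  have "T 1 3 \<in> recurrent"
    using B_gt odd_B by (force simp: recurrent_def odds_def)
  then have "c_max B \<in> card ` terminal_cycles B"
    unfolding c_max_def terminal_cycles_eq using finite_recurrent by (intro Max_in) auto
  then obtain s where s: "s \<in> recurrent" "c_max B = card (orbit (kaprekar B) s)"
    by (auto simp: terminal_cycles_eq)
  then obtain x y where "x \<in> odds" "y \<in> odds" "x \<noteq> y" "s = T x y"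
    by (auto simp: recurrent_def)
  then have "(kaprekar B ^^ n) s = s"
    using n(3) by (simp add: kaprekar_funpow_T funpow_f_eq_self)
  then have "c_max B \<le> n"
    using card_orbit_le n(1) s(2) by metis
  then have "n = c_max B"
    using n(2) assms by (simp add: card_odds)
  then show "(f ^^ c_max B) 1 = 1" "inj_on (\<lambda>i. (f ^^ i) 1) {..<c_max B}"
    using n by auto
qed

end

section \<open>Counting the longest cycles\<close>

locale maximal_cycle = odd_base +
  fixes m :: nat
  assumes m_eq: "m = (B - 1) div 2"
    and f_m: "(f ^^ m) 1 = 1"
    and inj_m: "inj_on (\<lambda>i. (f ^^ i) 1) {..<m}"
begin

text \<open>The odd representative of the class of \<open>2 ^ i\<close> modulo \<open>B\<close> and
  sign; \<open>i\<close> serves as a discrete logarithm.\<close>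

definition p :: "nat \<Rightarrow> nat" where
  "p i = (f ^^ i) 1"

definition cycle :: "nat \<Rightarrow> nat list set" where
  "cycle d = range (\<lambda>i. T (p i) (p (i + d)))"

lemma m_pos: "0 < m"
  using B_gt m_eq by simp

lemma p_odds: "p i \<in> odds"
  unfolding p_def by (rule funpow_in[OF f_odds one_odds])

lemma p_mod: "p (i mod m) = p i"
  unfolding p_def using f_m by (rule funpow_mod_eq)

lemma p_eq_iff: "p i = p j \<longleftrightarrow> i mod m = j mod m"
proof
  assume "p i = p j"
  then have "p (i mod m) = p (j mod m)"
    by (simp add: p_mod)
  then show "i mod m = j mod m"
    using inj_m m_pos by (auto simp: p_def inj_on_def)
qed (metis p_mod)

text \<open>The first \<open>m\<close> iterates of 1 are distinct, and there are only
  \<open>m\<close> odd numbers below \<open>B\<close>.\<close>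

lemma odds_eq: "odds = p ` {..<m}"
proof (rule card_subset_eq[symmetric])
  have "inj_on p {..<m}"
    using inj_m by (simp add: p_def[abs_def])
  then show "card (p ` {..<m}) = card odds"
    by (simp add: card_image card_odds m_eq)
qed (use finite_odds p_odds in auto)

text \<open>A proper divisor \<open>q\<close> other than 1 is itself in \<open>odds\<close>, hence
  congruent to plus or minus some \<open>2 ^ i\<close> modulo \<open>B\<close>. As \<open>q\<close>
  divides \<open>B\<close>, it would divide \<open>2 ^ i\<close>, although it is odd.\<close>

lemma prime_B: "prime B"
proof (rule ccontr)
  assume "\<not> prime B"
  then obtain q where q: "q dvd B" "q \<noteq> 1" "q \<noteq> B"
    using B_gt by (auto simp: prime_nat_iff)
  then have "odd q" "q < B"
    using odd_B B_gt by (auto dest: dvd_trans dvd_imp_le)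
  then obtain i where i: "q = p i"
    using odds_eq by (auto simp: odds_def)
  have "int q dvd int B"
    using q(1) by simp
  moreover have "int B dvd int q - 2 ^ i \<or> int B dvd int q + 2 ^ i"
    using funpow_f_cong[of i 1] by (simp add: i p_def)
  ultimately have "int q dvd int q - 2 ^ i \<or> int q dvd int q + 2 ^ i"
    using dvd_trans by blast
  then have "int q dvd 2 ^ i"
    by (metis dvd_add_right_iff dvd_diff_right_iff dvd_refl)
  then have "q dvd 2 ^ i"
    by (metis int_dvd_int_iff of_nat_numeral of_nat_power)
  moreover have "coprime q (2 ^ i)"
    using \<open>odd q\<close> by simp
  ultimately show False
    using q(2) by (metis coprime_iff_gcd_eq_1 gcd_nat.absorb1)
qed

lemma p_add_ne:
  assumes "0 < d" "d < m"
  shows "p i \<noteq> p (i + d)"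
proof
  assume "p i = p (i + d)"
  then have "m dvd (i + d) - i"
    by (metis le_add1 mod_eq_dvd_iff_nat p_eq_iff)
  then show False
    using assms by (auto dest: dvd_imp_le)
qed

lemma T_p_recurrent:
  assumes "0 < d" "d < m"
  shows "T (p i) (p (i + d)) \<in> recurrent"
  using p_odds p_add_ne[OF assms] by (auto simp: recurrent_def)

text \<open>Each step raises both indices by 1 and keeps their distance \<open>d\<close>. Indices
  count modulo \<open>m\<close>, so every starting index lies on the same orbit.\<close>

lemma orbit_T_p:
  assumes "0 < d" "d < m"
  shows "orbit (kaprekar B) (T (p i) (p (i + d))) = cycle d"
proof -
  have pow: "(kaprekar B ^^ k) (T (p 0) (p d)) = T (p k) (p (k + d))" for k
    using kaprekar_funpow_T[OF p_odds p_odds p_add_ne[OF assms, of 0], of k]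
    by (simp add: p_def funpow_add)
  have self: "T (p 0) (p d) \<in> orbit (kaprekar B) (T (p 0) (p d))"
    using recurrent_in_orbit T_p_recurrent[OF assms, of 0] by simp
  have "orbit (kaprekar B) (T (p 0) (p d)) = cycle d"
    unfolding orbit_altdef_self_in[OF self] pow cycle_def by auto
  moreover have "T (p i) (p (i + d)) \<in> cycle d"
    by (auto simp: cycle_def)
  ultimately show ?thesis
    using orbit_eq_orbit[OF self] by simp
qed

lemma card_cycle:
  assumes "0 < d" "2 * d < m"
  shows "card (cycle d) = m"
proof -
  have "T (p i) (p (i + d)) \<in> (\<lambda>i. T (p i) (p (i + d))) ` {..<m}" for i
  proof -
    have "p (i + d) = p (i mod m + d)"
      by (simp add: p_eq_iff mod_add_left_eq)
    then show ?thesis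
      using m_pos p_mod by (intro image_eqI[of _ _ "i mod m"]) auto
  qed
  then have "cycle d = (\<lambda>i. T (p i) (p (i + d))) ` {..<m}"
    by (auto simp: cycle_def)
  moreover have "inj_on (\<lambda>i. T (p i) (p (i + d))) {..<m}"
  proof (rule inj_onI)
    fix i j assume ij: "i \<in> {..<m}" "j \<in> {..<m}"
      and eq: "T (p i) (p (i + d)) = T (p j) (p (j + d))"
    have "p i = p j \<or> p i = p (j + d) \<and> p (i + d) = p j"
      using eq p_odds by (auto simp: T_eq_T_iff)
    then show "i = j"
    proof
      assume "p i = p j"
      then show "i = j"
        using ij by (simp add: p_eq_iff)
    next
      \<comment> \<open>A match with swapped entries would force \<open>m\<close> to divide
        \<open>2 * d\<close>.\<close>
      assume "p i = p (j + d) \<and> p (i + d) = p j"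
      then have "p i = p (i + 2 * d)"
        by (simp add: p_eq_iff) (metis add.assoc mod_add_left_eq mult_2)
      then show "i = j"
        using p_add_ne[of "2 * d" i] assms by simp
    qed
  qed
  ultimately show ?thesis
    by (simp add: card_image)
qed

text \<open>The unordered pair determines its distance up to replacing \<open>d\<close> by
  \<open>m - d\<close>, and two distances below \<open>m / 2\<close> cannot add up to
  \<open>m\<close>.\<close>

lemma inj_on_cycle: "inj_on cycle {d. 0 < d \<and> 2 * d < m}"
proof (rule inj_onI)
  fix d e assume de: "d \<in> {d. 0 < d \<and> 2 * d < m}" "e \<in> {d. 0 < d \<and> 2 * d < m}"
    and eq: "cycle d = cycle e"
  have "T (p 0) (p (0 + d)) \<in> cycle d"
    unfolding cycle_def by (rule rangeI)
  then obtain i where "T (p 0) (p d) = T (p i) (p (i + e))"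
    unfolding eq by (auto simp: cycle_def)
  then have "p 0 = p i \<and> p d = p (i + e) \<or> p 0 = p (i + e) \<and> p d = p i"
    using p_odds by (simp add: T_eq_T_iff)
  then show "d = e"
  proof
    assume *: "p 0 = p i \<and> p d = p (i + e)"
    then have "p d = p e"
      by (simp add: p_eq_iff) (metis add_0 mod_add_left_eq mod_0)
    then show "d = e"
      using de by (simp add: p_eq_iff)
  next
    assume *: "p 0 = p (i + e) \<and> p d = p i"
    then have "p 0 = p (0 + (d + e))"
      by (simp add: p_eq_iff) (metis mod_add_left_eq)
    then show "d = e"
      using p_add_ne[of "d + e" 0] de by simp
  qed
qed

lemma longest_cycles_eq:
  "{C \<in> terminal_cycles B. card C = m} = cycle ` {d. 0 < d \<and> 2 * d < m}"
proof (intro equalityI subsetI)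
  fix C assume "C \<in> {C \<in> terminal_cycles B. card C = m}"
  then obtain s where s: "s \<in> recurrent" "C = orbit (kaprekar B) s" "card C = m"
    by (auto simp: terminal_cycles_eq)
  then obtain x y where "x \<in> odds" "y \<in> odds" "x \<noteq> y" "s = T x y"
    by (auto simp: recurrent_def)
  then obtain i j where "i < m" "j < m" "i \<noteq> j" "s = T (p i) (p j)"
    by (auto simp: odds_eq)
  then obtain i j where ij: "i < j" "j < m" "s = T (p i) (p j)"
    by (metis T_commute linorder_neq_iff)
  define e where "e = j - i"
  have e: "0 < e" "e < m" "s = T (p i) (p (i + e))"
    using ij by (auto simp: e_def)
  consider "2 * e < m" | "2 * e = m" | "2 * e > m" by linarith
  then show "C \<in> cycle ` {d. 0 < d \<and> 2 * d < m}"
  proof cases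
    case 1
    then show ?thesis
      using e s orbit_T_p by auto
  next
    case 2
    \<comment> \<open>At distance \<open>m / 2\<close> the pair returns with its entries swapped
      after only \<open>e\<close> steps, so this cycle is too short.\<close>
    have "(kaprekar B ^^ e) s = T (p (i + e)) (p (i + e + e))"
      using kaprekar_funpow_T[of "p i" "p (i + e)" e] p_odds p_add_ne e
      by (simp add: p_def flip: funpow_add comp_apply[of "f ^^ _" "f ^^ _"])
        (simp add: add_ac)
    also have "p (i + e + e) = p i"
      using 2 by (simp add: p_eq_iff add.assoc flip: mult_2)
    finally have "(kaprekar B ^^ e) s = s"
      using e(3) by (simp add: T_commute)
    then have "card C \<le> e"
      using card_orbit_le e(1) s(2) by metis
    then show ?thesis
      using s(3) e(2) by simp
  next
    case 3
    \<comment> \<open>Reading the pair from its other entry replaces the distance \<open>e\<close>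
      by \<open>m - e\<close>.\<close>
    have "p i = p (i + e + (m - e))"
      using e by (simp add: p_eq_iff)
    then have "s = T (p (i + e)) (p (i + e + (m - e)))"
      using e by (metis T_commute)
    then have "C = cycle (m - e)"
      using orbit_T_p[of "m - e" "i + e"] e s by simp
    then show ?thesis
      using 3 e by auto
  qed
next
  fix C assume "C \<in> cycle ` {d. 0 < d \<and> 2 * d < m}"
  then obtain d where d: "0 < d" "2 * d < m" "C = cycle d"
    by auto
  moreover have "cycle d \<in> terminal_cycles B"
    unfolding terminal_cycles_eq using d T_p_recurrent[of d 0] orbit_T_p[of d 0]
    by (intro image_eqI[of _ _ "T (p 0) (p (0 + d))"]) auto
  ultimately show "C \<in> {C \<in> terminal_cycles B. card C = m}"
    using card_cycle by simp
qed

lemma card_longest_cycles: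
  "card {C \<in> terminal_cycles B. card C = m} = (m - 1) div 2"
proof -
  have "{d. 0 < d \<and> 2 * d < m} = {1..(m - 1) div 2}"
    by auto
  then show ?thesis
    using card_image[OF inj_on_cycle] by (simp add: longest_cycles_eq)
qed

end

theorem corollary1p3:
  fixes B :: nat
  assumes "B > 3" and "odd B"
    and "real (c_max B) = (real B - 1) / 2"
  shows "prime B \<and>
    int (card {C \<in> terminal_cycles B. card C = c_max B})
      = \<lfloor>(real (c_max B) - 1) / 2\<rfloor>"
proof -
  interpret odd_base B
    by unfold_locales (use assms in auto)
  have "real B = real (2 * c_max B + 1)"
    using assms(3) by simp
  then have "B = 2 * c_max B + 1"
    by (simp only: of_nat_eq_iff)
  then have c: "c_max B = (B - 1) div 2" "0 < c_max B"
    using assms(1) by auto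
  interpret maximal_cycle B "c_max B"
    by unfold_locales (use c funpow_f_one_if_c_max in auto)
  \<comment> \<open>Positivity of \<open>c_max B\<close> makes natural and real subtraction of 1
    agree.\<close>
  have "\<lfloor>(real (c_max B) - 1) / 2\<rfloor> = \<lfloor>real (c_max B - 1) / real 2\<rfloor>"
    using c(2) by (simp add: of_nat_diff)
  also have "\<dots> = int ((c_max B - 1) div 2)"
    by (rule floor_divide_of_nat_eq)
  finally show ?thesis
    using prime_B card_longest_cycles by simp
qed

end
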